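(* Let $(\boldsymbol{x},\boldsymbol{n},\boldsymbol{s}):U\to\mathbb{R}^3\times\Delta$ be a framed surface with basic invariants $a_i,b_i,e_i,f_i,g_i$ ($i=1,2$). (1) Suppose that there exist smooth functions $\lambda^{s,t},\theta^{s,t}:U\to\mathbb{R}$ such that for $i=1,2$, on $U$, $\lambda^{s,t}e_i\sin\theta^{s,t}+(b_i+\lambda^{s,t}g_i)\cos\theta^{s,t}=0$, and form $\mathcal{S}^t(\boldsymbol{x},\boldsymbol{n},\boldsymbol{s})$ with them. If we take $\lambda^{t,s}=-\lambda^{s,t}$ and $\theta^{t,s}=-\theta^{s,t}$, then $\mathcal{T}^{s}(\mathcal{S}^{t}(\boldsymbol{x},\boldsymbol{n},\boldsymbol{s}))=(\boldsymbol{x},\boldsymbol{n},\boldsymbol{s})$ (in particular, these functions satisfy the condition required to form $\mathcal{T}^s$ of $\mathcal{S}^{t}(\boldsymbol{x},\boldsymbol{n},\boldsymbol{s})$). (2) Suppose that there exist smooth functions $\lambda^{t,s},\theta^{t,s}:U\to\mathbb{R}$ such that for $i=1,2$, on $U$, $-\lambda^{t,s}f_i\sin\theta^{t,s}+(a_i-\lambda^{t,s}g_i)\cos\theta^{t,s}=0$, and form $\mathcal{T}^s(\boldsymbol{x},\boldsymbol{n},\boldsymbol{s})$ with them. If we take $\lambda^{s,t}=-\lambda^{t,s}$ and $\theta^{s,t}=-\theta^{t,s}$, then $\mathcal{S}^{t}(\mathcal{T}^{s}(\boldsymbol{x},\boldsymbol{n},\boldsymbol{s}))=(\boldsymbol{x},\boldsymbol{n},\boldsymbol{s})$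 (in particular, these functions satisfy the condition required to form $\mathcal{S}^t$ of $\mathcal{T}^{s}(\boldsymbol{x},\boldsymbol{n},\boldsymbol{s})$).
   Context: All maps are $C^\infty$. $U\subset\mathbb{R}^2$ is a simply connected domain with coordinates $(u,v)$, $S^2$ is the unit sphere in $\mathbb{R}^3$, and $\Delta=\{(\boldsymbol{a},\boldsymbol{b})\in S^2\times S^2 : \boldsymbol{a}\cdot\boldsymbol{b}=0\}$. A framed surface is a smooth map $(\boldsymbol{x},\boldsymbol{n},\boldsymbol{s}):U\to\mathbb{R}^3\times\Delta$ with $\boldsymbol{x}_u\cdot\boldsymbol{n}=\boldsymbol{x}_v\cdot\boldsymbol{n}=0$ on $U$. Put $\boldsymbol{t}=\boldsymbol{n}\times\boldsymbol{s}$. Its basic invariants are the smooth functions $a_i,b_i,e_i,f_i,g_i:U\to\mathbb{R}$ ($i=1,2$) determined by $\boldsymbol{x}_u=a_1\boldsymbol{s}+b_1\boldsymbol{t}$, $\boldsymbol{n}_u=e_1\boldsymbol{s}+f_1\boldsymbol{t}$, $\boldsymbol{s}_u=-e_1\boldsymbol{n}+g_1\boldsymbol{t}$, $\boldsymbol{t}_u=-f_1\boldsymbol{n}-g_1\boldsymbol{s}$, and the same equations with $\partial_v$ in place of $\partial_u$ and index $2$ in place of $1$. Tangential direction framed surfaces. The operations below send a framed surface (with the indicated auxiliary functions) to a framed surface; when an operation is applied to another framed surface, the invariants and frame vectors $\boldsymbol{n},\boldsymbol{s},\boldsymbol{t}$ in its definition are those of that framed surface. $\mathcal{S}^{t}(\boldsymbol{x},\boldsymbol{n},\boldsymbol{s})=(\boldsymbol{x}+\lambda^{s,t}\boldsymbol{s},\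 \cos\theta^{s,t}\boldsymbol{t}-\sin\theta^{s,t}\boldsymbol{n},\ \sin\theta^{s,t}\boldsymbol{t}+\cos\theta^{s,t}\boldsymbol{n})$, where $\lambda^{s,t},\theta^{s,t}:U\to\mathbb{R}$ are smooth functions satisfying $\lambda^{s,t}e_i\sin\theta^{s,t}+(b_i+\lambda^{s,t}g_i)\cos\theta^{s,t}=0$ on $U$ for $i=1,2$. $\mathcal{T}^{s}(\boldsymbol{x},\boldsymbol{n},\boldsymbol{s})=(\boldsymbol{x}+\lambda^{t,s}\boldsymbol{t},\ \sin\theta^{t,s}\boldsymbol{n}+\cos\theta^{t,s}\boldsymbol{s},\ \boldsymbol{t})$, where $\lambda^{t,s},\theta^{t,s}:U\to\mathbb{R}$ are smooth functions satisfying $-\lambda^{t,s}f_i\sin\theta^{t,s}+(a_i-\lambda^{t,s}g_i)\cos\theta^{t,s}=0$ on $U$ for $i=1,2$. *)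

theory Defs
  imports "HOL-Analysis.Analysis"
begin

(* The library has no C^k predicate for maps between normed spaces.  On an open set the
   recursion below is the usual one: f is C^(k+1) iff it is Frechet differentiable and all
   its directional derivatives are C^k. *)
primrec Ck_on :: "nat \<Rightarrow> 'a::real_normed_vector set \<Rightarrow> ('a \<Rightarrow> 'b::real_normed_vector) \<Rightarrow> bool" where
  "Ck_on 0 U f \<longleftrightarrow> continuous_on U f"
| "Ck_on (Suc k) U f \<longleftrightarrow>
     (\<forall>p\<in>U. f differentiable (at p)) \<and> (\<forall>w. Ck_on k U (\<lambda>p. frechet_derivative f (at p) w))"

definition smooth_on :: "'a::real_normed_vector set \<Rightarrow> ('a \<Rightarrow> 'b::real_normed_vector) \<Rightarrow> bool" where
  "smooth_on U f \<longleftrightarrow> (\<forall>k. Ck_on k U f)"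

(* Indices i = 1, 2 range over the two-element type 2; coordinate 1 is u, coordinate 2 is v. *)
definition partial :: "2 \<Rightarrow> (real^2 \<Rightarrow> 'b::real_normed_vector) \<Rightarrow> real^2 \<Rightarrow> 'b" where
  "partial i f p = frechet_derivative f (at p) (axis i 1)"

definition plane_domain :: "(real^2) set \<Rightarrow> bool" where
  "plane_domain U \<longleftrightarrow> open U \<and> U \<noteq> {} \<and> simply_connected U"

definition Delta :: "((real^3) \<times> (real^3)) set" where
  "Delta = {(a, b). a \<in> sphere 0 1 \<and> b \<in> sphere 0 1 \<and> a \<bullet> b = 0}"

(* A map U -> R^3 x Delta is a total function whose values off U are irrelevant. *)
type_synonym framed_map = "real^2 \<Rightarrow> (real^3) \<times> (real^3) \<times> (real^3)"

definition xmap :: "framed_map \<Rightarrow> real^2 \<Rightarrow> real^3" where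
  "xmap F p = fst (F p)"

definition nmap :: "framed_map \<Rightarrow> real^2 \<Rightarrow> real^3" where
  "nmap F p = fst (snd (F p))"

definition smap :: "framed_map \<Rightarrow> real^2 \<Rightarrow> real^3" where
  "smap F p = snd (snd (F p))"

definition tmap :: "framed_map \<Rightarrow> real^2 \<Rightarrow> real^3" where
  "tmap F p = cross3 (nmap F p) (smap F p)"

definition framed_surface :: "(real^2) set \<Rightarrow> framed_map \<Rightarrow> bool" where
  "framed_surface U F \<longleftrightarrow>
     smooth_on U F \<and>
     (\<forall>p\<in>U. (nmap F p, smap F p) \<in> Delta) \<and>
     (\<forall>p\<in>U. \<forall>i. partial i (xmap F) p \<bullet> nmap F p = 0)"

definition basic_invariants ::
  "(real^2) set \<Rightarrow> framed_map \<Rightarrow> (2 \<Rightarrow> real^2 \<Rightarrow> real) \<Rightarrow> (2 \<Rightarrow> real^2 \<Rightarrow> real) \<Rightarrow>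
   (2 \<Rightarrow> real^2 \<Rightarrow> real) \<Rightarrow> (2 \<Rightarrow> real^2 \<Rightarrow> real) \<Rightarrow> (2 \<Rightarrow> real^2 \<Rightarrow> real) \<Rightarrow> bool" where
  "basic_invariants U F a b e f g \<longleftrightarrow>
     (\<forall>i. smooth_on U (a i) \<and> smooth_on U (b i) \<and> smooth_on U (e i) \<and>
          smooth_on U (f i) \<and> smooth_on U (g i)) \<and>
     (\<forall>p\<in>U. \<forall>i.
        partial i (xmap F) p = a i p *\<^sub>R smap F p + b i p *\<^sub>R tmap F p \<and>
        partial i (nmap F) p = e i p *\<^sub>R smap F p + f i p *\<^sub>R tmap F p \<and>
        partial i (smap F) p = - e i p *\<^sub>R nmap F p + g i p *\<^sub>R tmap F p \<and>
        partial i (tmap F) p = - f i p *\<^sub>R nmap F p - g i p *\<^sub>R smap F p)"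

(* Hence "the" basic invariants: two families satisfying the defining equations agree on U. *)
lemma basic_invariants_unique:
  assumes F: "framed_surface U F" and p: "p \<in> U"
    and I: "basic_invariants U F a b e f g" and I': "basic_invariants U F a' b' e' f' g'"
  shows "a i p = a' i p" "b i p = b' i p" "e i p = e' i p" "f i p = f' i p" "g i p = g' i p"
proof -
  let ?n = "nmap F p" and ?s = "smap F p" and ?t = "tmap F p"
  have d: "?n \<bullet> ?n = 1" "?s \<bullet> ?s = 1" "?n \<bullet> ?s = 0"
    using F p by (auto simp: framed_surface_def Delta_def dist_norm norm_eq_1)
  have t: "?t \<bullet> ?n = 0" "?t \<bullet> ?s = 0" "?n \<bullet> ?t = 0" "?s \<bullet> ?t = 0"
    by (simp_all add: tmap_def dot_cross_self)
  have tt: "?t \<bullet> ?t = 1"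
    using dot_cross[of ?n ?s ?n ?s] d by (simp add: tmap_def inner_commute)
  have *: "al i p = partial i (xmap F) p \<bullet> ?s \<and> be i p = partial i (xmap F) p \<bullet> ?t \<and>
        ep i p = partial i (nmap F) p \<bullet> ?s \<and> ph i p = partial i (nmap F) p \<bullet> ?t \<and>
        ga i p = partial i (smap F) p \<bullet> ?t"
    if "basic_invariants U F al be ep ph ga" for al be ep ph ga
    using that p d t tt by (simp add: basic_invariants_def inner_simps)
  show "a i p = a' i p" "b i p = b' i p" "e i p = e' i p" "f i p = f' i p" "g i p = g' i p"
    using *[OF I] *[OF I'] by simp_all
qed

(* Conditions on the auxiliary functions (lam, th) for the operations St and Ts to be formed;
   the function arguments are basic invariants of the surface the operation is applied to. *)
definition St_condition ::
  "(real^2) set \<Rightarrow> (2 \<Rightarrow> real^2 \<Rightarrow> real) \<Rightarrow> (2 \<Rightarrow> real^2 \<Rightarrow> real) \<Rightarrow> (2 \<Rightarrow> real^2 \<Rightarrow> real) \<Rightarrow>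
   (real^2 \<Rightarrow> real) \<Rightarrow> (real^2 \<Rightarrow> real) \<Rightarrow> bool" where
  "St_condition U b e g lam th \<longleftrightarrow>
     smooth_on U lam \<and> smooth_on U th \<and>
     (\<forall>p\<in>U. \<forall>i. lam p * e i p * sin (th p) + (b i p + lam p * g i p) * cos (th p) = 0)"

definition Ts_condition ::
  "(real^2) set \<Rightarrow> (2 \<Rightarrow> real^2 \<Rightarrow> real) \<Rightarrow> (2 \<Rightarrow> real^2 \<Rightarrow> real) \<Rightarrow> (2 \<Rightarrow> real^2 \<Rightarrow> real) \<Rightarrow>
   (real^2 \<Rightarrow> real) \<Rightarrow> (real^2 \<Rightarrow> real) \<Rightarrow> bool" where
  "Ts_condition U a f g lam th \<longleftrightarrow>
     smooth_on U lam \<and> smooth_on U th \<and>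
     (\<forall>p\<in>U. \<forall>i. - lam p * f i p * sin (th p) + (a i p - lam p * g i p) * cos (th p) = 0)"

definition St :: "(real^2 \<Rightarrow> real) \<Rightarrow> (real^2 \<Rightarrow> real) \<Rightarrow> framed_map \<Rightarrow> framed_map" where
  "St lam th F = (\<lambda>p.
     (xmap F p + lam p *\<^sub>R smap F p,
      cos (th p) *\<^sub>R tmap F p - sin (th p) *\<^sub>R nmap F p,
      sin (th p) *\<^sub>R tmap F p + cos (th p) *\<^sub>R nmap F p))"

definition Ts :: "(real^2 \<Rightarrow> real) \<Rightarrow> (real^2 \<Rightarrow> real) \<Rightarrow> framed_map \<Rightarrow> framed_map" where
  "Ts lam th F = (\<lambda>p.
     (xmap F p + lam p *\<^sub>R tmap F p,
      sin (th p) *\<^sub>R nmap F p + cos (th p) *\<^sub>R smap F p,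
      tmap F p))"

end

theory Submission
  imports Defs
begin

text \<open>
  Both operations rotate the orthonormal frame and move the base point along a frame vector: by
  \<open>s\<close> in \<open>St\<close>, which becomes the new \<open>t\<close>, and by \<open>t\<close> in \<open>Ts\<close>, which becomes the new \<open>s\<close>. At each
  point, \<open>St\<close> followed by \<open>Ts\<close> with negated functions therefore translates by \<open>\<lambda>\<close> and then by
  \<open>-\<lambda>\<close> along the same vector, and it rotates the frame back; the opposite composition is similar
  (\<open>Ts_St_inverse\<close>, \<open>St_Ts_inverse\<close>).

  The remaining point is that the negated functions satisfy the condition needed to form the second
  operation. No invariants of the intermediate surface have to be computed for this. The left-hand
  side of the condition on \<open>(\<lambda>, \<theta>)\<close> is exactly the inner product of \<open>\<partial>\<^sub>i x\<close> with \<open>n\<close> for the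
  transformed map (\<open>St_tangency\<close>, \<open>Ts_tangency\<close>), so the condition says that the new \<open>n\<close>
  is again normal to the new \<open>x\<close>. The second operation turns the intermediate surface back into
  \<open>F\<close>, where this holds because \<open>F\<close> is a framed surface.

  To speak of the condition for the intermediate surface one needs its basic invariants as smooth
  functions. Every framed surface has them: they are the coordinates of the partial derivatives in
  the moving frame (\<open>framed_surface_has_basic_invariants\<close>).
\<close>

section \<open>Calculus of smooth maps\<close>

lemma Ck_on_cong:
  assumes "open U" "\<And>p. p \<in> U \<Longrightarrow> f p = g p" "Ck_on k U f"
  shows "Ck_on k U g"
  using assms(2,3)
proof (induction k arbitrary: f g)
  case 0
  then show ?case by (simp cong: continuous_on_cong)
next
  case (Suc k)
  have der: "(g has_derivative frechet_derivative f (at p)) (at p)" if "p \<in> U" for p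
    using Suc.prems \<open>open U\<close> that
    by (auto simp: frechet_derivative_works intro: has_derivative_transform_within_open)
  then have "frechet_derivative f (at p) = frechet_derivative g (at p)" if "p \<in> U" for p
    using that frechet_derivative_at by blast
  then have "Ck_on k U (\<lambda>p. frechet_derivative g (at p) w)" for w
    using Suc.IH[of "\<lambda>p. frechet_derivative f (at p) w" "\<lambda>p. frechet_derivative g (at p) w"]
      Suc.prems by auto
  with der show ?case
    by (auto simp: differentiable_def)
qed

lemma Ck_on_SucI:
  assumes "open U" and der: "\<And>p. p \<in> U \<Longrightarrow> (f has_derivative f' p) (at p)"
    and "\<And>w. Ck_on k U (\<lambda>p. f' p w)"
  shows "Ck_on (Suc k) U f"
proof -
  have "Ck_on k U (\<lambda>p. frechet_derivative f (at p) w)" for w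
  proof (rule Ck_on_cong[OF \<open>open U\<close> _ assms(3)])
    show "f' p w = frechet_derivative f (at p) w" if "p \<in> U" for p
      using frechet_derivative_at[OF der[OF that]] by simp
  qed
  with der show ?thesis by (auto simp: differentiable_def)
qed

lemma Ck_on_SucD_has_derivative:
  "Ck_on (Suc k) U f \<Longrightarrow> p \<in> U \<Longrightarrow> (f has_derivative frechet_derivative f (at p)) (at p)"
  by (simp add: frechet_derivative_works)

lemma Ck_on_SucD: "Ck_on (Suc k) U f \<Longrightarrow> Ck_on k U f"
proof (induction k arbitrary: f)
  case 0
  then show ?case
    by (auto intro!: continuous_at_imp_continuous_on differentiable_imp_continuous_within)
qed auto

lemma Ck_on_bounded_linear:
  assumes "open U" "bounded_linear h" "Ck_on k U f"
  shows "Ck_on k U (\<lambda>p. h (f p))"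
  using assms(3)
proof (induction k arbitrary: f)
  case 0
  then show ?case by (simp add: assms(2) bounded_linear.continuous_on)
next
  case (Suc k)
  show ?case
  proof (rule Ck_on_SucI[OF \<open>open U\<close>])
    show "((\<lambda>p. h (f p)) has_derivative (\<lambda>w. h (frechet_derivative f (at p) w))) (at p)"
      if "p \<in> U" for p
      using bounded_linear.has_derivative[OF assms(2) Ck_on_SucD_has_derivative[OF Suc.prems that]] .
    show "Ck_on k U (\<lambda>p. h (frechet_derivative f (at p) w))" for w
      using Suc by simp
  qed
qed

lemma Ck_on_add:
  assumes "open U" "Ck_on k U f" "Ck_on k U g"
  shows "Ck_on k U (\<lambda>p. f p + g p)"
  using assms(2,3)
proof (induction k arbitrary: f g)
  case 0
  then show ?case by (simp add: continuous_on_add)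
next
  case (Suc k)
  show ?case
    by (rule Ck_on_SucI[OF \<open>open U\<close> has_derivative_add[OF Ck_on_SucD_has_derivative[OF Suc.prems(1)]
            Ck_on_SucD_has_derivative[OF Suc.prems(2)]]])
      (use Suc in auto)
qed

lemma Ck_on_bounded_bilinear:
  assumes "open U" and h: "bounded_bilinear h" and "Ck_on k U f" "Ck_on k U g"
  shows "Ck_on k U (\<lambda>p. h (f p) (g p))"
  using assms(3,4)
proof (induction k arbitrary: f g)
  case 0
  then show ?case by (simp add: bounded_bilinear.continuous_on[OF h])
next
  case (Suc k)
  show ?case
  proof (rule Ck_on_SucI[OF \<open>open U\<close> bounded_bilinear.FDERIV[OF h
          Ck_on_SucD_has_derivative[OF Suc.prems(1)] Ck_on_SucD_has_derivative[OF Suc.prems(2)]]])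
    show "Ck_on k U (\<lambda>p. h (f p) (frechet_derivative g (at p) w)
        + h (frechet_derivative f (at p) w) (g p))" for w
      using Suc.prems Ck_on_SucD[OF Suc.prems(1)] Ck_on_SucD[OF Suc.prems(2)]
      by (intro Ck_on_add[OF \<open>open U\<close>] Suc.IH) simp_all
  qed auto
qed

text \<open>
  Sine and cosine are treated together because each is, up to sign, the derivative of the other; this
  avoids a general chain rule for composition.
\<close>
lemma Ck_on_sin_cos:
  fixes h :: "'a::real_normed_vector \<Rightarrow> real"
  assumes "open U" "Ck_on k U h"
  shows "Ck_on k U (\<lambda>p. sin (h p)) \<and> Ck_on k U (\<lambda>p. cos (h p))"
  using assms(2)
proof (induction k)
  case 0
  then show ?case by (simp add: continuous_on_sin continuous_on_cos)
next
  case (Suc k)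
  have sc: "Ck_on k U (\<lambda>p. sin (h p))" "Ck_on k U (\<lambda>p. cos (h p))"
    using Suc.IH Ck_on_SucD[OF Suc.prems] by auto
  have dh: "Ck_on k U (\<lambda>p. frechet_derivative h (at p) w)" for w
    using Suc.prems by simp
  note D = Ck_on_SucD_has_derivative[OF Suc.prems]
  have "Ck_on k U (\<lambda>p. frechet_derivative h (at p) w * cos (h p))" for w
    using Ck_on_bounded_bilinear[OF \<open>open U\<close> bounded_bilinear_mult dh sc(2)] .
  then have 1: "Ck_on (Suc k) U (\<lambda>p. sin (h p))"
    using Ck_on_SucI[OF \<open>open U\<close> has_derivative_sin[OF D]] by blast
  have "Ck_on k U (\<lambda>p. - (frechet_derivative h (at p) w * sin (h p)))" for w
    using Ck_on_bounded_linear[OF \<open>open U\<close> bounded_linear_minus[OF bounded_linear_ident]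
        Ck_on_bounded_bilinear[OF \<open>open U\<close> bounded_bilinear_mult dh sc(1)]] .
  then have 2: "Ck_on (Suc k) U (\<lambda>p. cos (h p))"
    using Ck_on_SucI[OF \<open>open U\<close> has_derivative_cos[OF D]] by fastforce
  show ?case using 1 2 by blast
qed

lemma smooth_on_imp_differentiable:
  "smooth_on U f \<Longrightarrow> p \<in> U \<Longrightarrow> f differentiable (at p)"
  by (metis Ck_on.simps(2) smooth_on_def)

lemma smooth_on_bounded_linear:
  "open U \<Longrightarrow> bounded_linear h \<Longrightarrow> smooth_on U f \<Longrightarrow> smooth_on U (\<lambda>p. h (f p))"
  by (simp add: smooth_on_def Ck_on_bounded_linear)

lemma smooth_on_bounded_bilinear:
  "open U \<Longrightarrow> bounded_bilinear h \<Longrightarrow> smooth_on U f \<Longrightarrow> smooth_on U g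
    \<Longrightarrow> smooth_on U (\<lambda>p. h (f p) (g p))"
  by (simp add: smooth_on_def Ck_on_bounded_bilinear)

lemmas smooth_on_scaleR = smooth_on_bounded_bilinear[OF _ bounded_bilinear_scaleR]
lemmas smooth_on_inner = smooth_on_bounded_bilinear[OF _ bounded_bilinear_inner]

lemma smooth_on_add:
  "open U \<Longrightarrow> smooth_on U f \<Longrightarrow> smooth_on U g \<Longrightarrow> smooth_on U (\<lambda>p. f p + g p)"
  by (simp add: smooth_on_def Ck_on_add)

lemma smooth_on_minus: "open U \<Longrightarrow> smooth_on U f \<Longrightarrow> smooth_on U (\<lambda>p. - f p)"
  using smooth_on_bounded_linear[OF _ bounded_linear_minus[OF bounded_linear_ident]] .

lemma smooth_on_diff:
  "open U \<Longrightarrow> smooth_on U f \<Longrightarrow> smooth_on U g \<Longrightarrow> smooth_on U (\<lambda>p. f p - g p)"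
  using smooth_on_add[of U f "\<lambda>p. - g p"] smooth_on_minus[of U g] by simp

lemma smooth_on_sin: "open U \<Longrightarrow> smooth_on U h \<Longrightarrow> smooth_on U (\<lambda>p. sin (h p))"
  and smooth_on_cos: "open U \<Longrightarrow> smooth_on U h \<Longrightarrow> smooth_on U (\<lambda>p. cos (h p))"
  for h :: "'a::real_normed_vector \<Rightarrow> real"
  by (simp_all add: smooth_on_def Ck_on_sin_cos)

lemma smooth_on_Pair:
  assumes "open U" "smooth_on U f" "smooth_on U g"
  shows "smooth_on U (\<lambda>p. (f p, g p))"
proof -
  have "bounded_linear (\<lambda>x. (x, 0::'c))" "bounded_linear (\<lambda>y. (0::'b, y))"
    by (auto intro!: bounded_linear_Pair bounded_linear_ident bounded_linear_zero)
  from smooth_on_add[OF assms(1) smooth_on_bounded_linear[OF assms(1) this(1) assms(2)]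
      smooth_on_bounded_linear[OF assms(1) this(2) assms(3)]]
  show ?thesis by simp
qed

lemma bounded_bilinear_cross3: "bounded_bilinear cross3"
  using bilinear_cross bilinear_conv_bounded_bilinear by blast

lemma smooth_on_partial: "smooth_on U f \<Longrightarrow> smooth_on U (partial i f)"
  unfolding smooth_on_def partial_def[abs_def] by (metis Ck_on.simps(2))

section \<open>Rules for partial derivatives\<close>

lemma partial_eqI: "(f has_derivative D) (at p) \<Longrightarrow> partial i f p = D (axis i 1)"
  using frechet_derivative_at by (metis partial_def)

lemma has_derivative_frechet:
  "f differentiable (at p) \<Longrightarrow> (f has_derivative frechet_derivative f (at p)) (at p)"
  by (simp add: frechet_derivative_works)

lemma partial_cong_open:
  assumes "open U" "p \<in> U" "\<And>q. q \<in> U \<Longrightarrow> f q = g q" "f differentiable (at p)"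
  shows "partial i g p = partial i f p"
  using partial_eqI[OF has_derivative_transform_within_open[OF has_derivative_frechet[OF assms(4)]
        assms(1-3)]]
  by (simp add: partial_def)

lemma partial_add:
  assumes "f differentiable (at p)" "g differentiable (at p)"
  shows "partial i (\<lambda>q. f q + g q) p = partial i f p + partial i g p"
  using partial_eqI[OF has_derivative_add[OF assms[THEN has_derivative_frechet]]]
  by (simp add: partial_def)

lemma partial_bounded_bilinear:
  assumes "bounded_bilinear h" "f differentiable (at p)" "g differentiable (at p)"
  shows "partial i (\<lambda>q. h (f q) (g q)) p = h (f p) (partial i g p) + h (partial i f p) (g p)"
  using partial_eqI[OF bounded_bilinear.FDERIV[OF assms(1) assms(2,3)[THEN has_derivative_frechet]]]
  by (simp add: partial_def)

lemmas partial_scaleR = partial_bounded_bilinear[OF bounded_bilinear_scaleR]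

text \<open>
  Differentiating a constant inner product: this is where the skew symmetry of the structure
  equations of a moving frame comes from.
\<close>
lemma partial_inner_const:
  fixes f g :: "real^2 \<Rightarrow> 'b::real_inner"
  assumes "open U" "p \<in> U" "\<And>q. q \<in> U \<Longrightarrow> f q \<bullet> g q = c"
    and "f differentiable (at p)" "g differentiable (at p)"
  shows "f p \<bullet> partial i g p + partial i f p \<bullet> g p = 0"
proof -
  have "partial i (\<lambda>q. f q \<bullet> g q) p = partial i (\<lambda>q. c) p"
    by (rule partial_cong_open[OF assms(1,2)]) (use assms(3) in auto)
  also have "\<dots> = 0"
    using partial_eqI[OF has_derivative_const] .
  finally show ?thesis
    using partial_bounded_bilinear[OF bounded_bilinear_inner assms(4,5)] by simp
qed

section \<open>The moving frame and its basic invariants\<close>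

lemma framed_surface_smooth_maps:
  assumes "open U" "framed_surface U F"
  shows "smooth_on U (xmap F)" "smooth_on U (nmap F)" "smooth_on U (smap F)" "smooth_on U (tmap F)"
proof -
  have F: "smooth_on U F" using assms(2) by (simp add: framed_surface_def)
  note sm = smooth_on_bounded_linear[OF assms(1)]
  show "smooth_on U (xmap F)"
    using sm[OF bounded_linear_fst F] by (simp add: xmap_def[abs_def])
  show n: "smooth_on U (nmap F)"
    using sm[OF bounded_linear_fst sm[OF bounded_linear_snd F]] by (simp add: nmap_def[abs_def])
  show s: "smooth_on U (smap F)"
    using sm[OF bounded_linear_snd sm[OF bounded_linear_snd F]] by (simp add: smap_def[abs_def])
  show "smooth_on U (tmap F)"
    using smooth_on_bounded_bilinear[OF assms(1) bounded_bilinear_cross3 n s]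
    by (simp add: tmap_def[abs_def])
qed

lemma framed_surface_frame:
  assumes "framed_surface U F" "p \<in> U"
  shows "nmap F p \<bullet> nmap F p = 1" "smap F p \<bullet> smap F p = 1" "tmap F p \<bullet> tmap F p = 1"
    "nmap F p \<bullet> smap F p = 0" "smap F p \<bullet> nmap F p = 0"
    "nmap F p \<bullet> tmap F p = 0" "tmap F p \<bullet> nmap F p = 0"
    "smap F p \<bullet> tmap F p = 0" "tmap F p \<bullet> smap F p = 0"
proof -
  show d: "nmap F p \<bullet> nmap F p = 1" "smap F p \<bullet> smap F p = 1" "nmap F p \<bullet> smap F p = 0"
    using assms by (auto simp: framed_surface_def Delta_def dist_norm norm_eq_1)
  then show "smap F p \<bullet> nmap F p = 0" by (simp add: inner_commute)
  show "nmap F p \<bullet> tmap F p = 0" "tmap F p \<bullet> nmap F p = 0"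
    "smap F p \<bullet> tmap F p = 0" "tmap F p \<bullet> smap F p = 0"
    by (simp_all add: tmap_def dot_cross_self)
  show "tmap F p \<bullet> tmap F p = 1"
    using dot_cross[of "nmap F p" "smap F p" "nmap F p" "smap F p"] d
    by (simp add: tmap_def inner_commute)
qed

lemma triple_cross: "cross3 (cross3 x y) z = (x \<bullet> z) *\<^sub>R y - (y \<bullet> z) *\<^sub>R x"
  using exhaust_3 by (force simp: cross3_simps)

lemma orthonormal_expansion:
  assumes "n \<bullet> n = 1" "s \<bullet> s = 1" "n \<bullet> s = 0"
  shows "v = (v \<bullet> n) *\<^sub>R n + (v \<bullet> s) *\<^sub>R s + (v \<bullet> cross3 n s) *\<^sub>R cross3 n s"
proof -
  let ?t = "cross3 n s"
  define w where "w = v - ((v \<bullet> n) *\<^sub>R n + (v \<bullet> s) *\<^sub>R s + (v \<bullet> ?t) *\<^sub>R ?t)"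
  have tt: "?t \<bullet> ?t = 1"
    using assms by (simp add: dot_cross inner_commute)
  have "n \<bullet> w = 0" "s \<bullet> w = 0" "?t \<bullet> w = 0"
    using assms tt unfolding w_def by (simp_all add: inner_simps dot_cross_self inner_commute)
  \<comment> \<open>The first two equations make \<open>w\<close> parallel to \<open>n \<times> s\<close>, the third makes it orthogonal to it.\<close>
  then have "cross3 ?t w = 0" "?t \<bullet> w = 0" by (simp_all add: triple_cross)
  then have "?t = 0 \<or> w = 0" using norm_and_cross_eq_0 by blast
  with tt have "w = 0" by auto
  then show ?thesis by (simp add: w_def)
qed

text \<open>
  Expanding the derivatives of \<open>x, n, s, t\<close> in the frame gives twelve coordinates for each \<open>i\<close>.
  Tangency removes one, and orthonormality makes the other nine frame coordinates a skew-symmetric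
  matrix; the five that remain are the basic invariants.
\<close>
lemma framed_surface_has_basic_invariants:
  assumes U: "open U" and F: "framed_surface U F"
  obtains a b e f g where "basic_invariants U F a b e f g"
proof -
  let ?a = "\<lambda>i p. partial i (xmap F) p \<bullet> smap F p" and ?b = "\<lambda>i p. partial i (xmap F) p \<bullet> tmap F p"
  let ?e = "\<lambda>i p. partial i (nmap F) p \<bullet> smap F p" and ?f = "\<lambda>i p. partial i (nmap F) p \<bullet> tmap F p"
  let ?g = "\<lambda>i p. partial i (smap F) p \<bullet> tmap F p"
  note sm = framed_surface_smooth_maps[OF U F]
  note df = sm[THEN smooth_on_imp_differentiable]
  have smooth: "smooth_on U (?a i)" "smooth_on U (?b i)" "smooth_on U (?e i)" "smooth_on U (?f i)"
    "smooth_on U (?g i)" for i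
    by (intro smooth_on_inner[OF U] smooth_on_partial sm)+
  have "partial i (xmap F) p = ?a i p *\<^sub>R smap F p + ?b i p *\<^sub>R tmap F p \<and>
        partial i (nmap F) p = ?e i p *\<^sub>R smap F p + ?f i p *\<^sub>R tmap F p \<and>
        partial i (smap F) p = - ?e i p *\<^sub>R nmap F p + ?g i p *\<^sub>R tmap F p \<and>
        partial i (tmap F) p = - ?f i p *\<^sub>R nmap F p - ?g i p *\<^sub>R smap F p" if p: "p \<in> U" for p i
  proof -
    note fr = framed_surface_frame[OF F]
    note skew = partial_inner_const[OF U p]
    have xn: "partial i (xmap F) p \<bullet> nmap F p = 0"
      using F p by (simp add: framed_surface_def)
    have nn: "partial i (nmap F) p \<bullet> nmap F p = 0"
      using skew[OF fr(1) df(2)[OF p] df(2)[OF p], of i] by (simp add: inner_commute)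
    have ss: "partial i (smap F) p \<bullet> smap F p = 0"
      using skew[OF fr(2) df(3)[OF p] df(3)[OF p], of i] by (simp add: inner_commute)
    have tt: "partial i (tmap F) p \<bullet> tmap F p = 0"
      using skew[OF fr(3) df(4)[OF p] df(4)[OF p], of i] by (simp add: inner_commute)
    have sn: "partial i (smap F) p \<bullet> nmap F p = - ?e i p"
      using skew[OF fr(4) df(2)[OF p] df(3)[OF p], of i] by (simp add: inner_commute)
    have tn: "partial i (tmap F) p \<bullet> nmap F p = - ?f i p"
      using skew[OF fr(6) df(2)[OF p] df(4)[OF p], of i] by (simp add: inner_commute)
    have ts: "partial i (tmap F) p \<bullet> smap F p = - ?g i p"
      using skew[OF fr(8) df(3)[OF p] df(4)[OF p], of i] by (simp add: inner_commute)
    note ex = orthonormal_expansion[OF fr(1,2,4)[OF p], folded tmap_def]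
    show ?thesis
      using ex[of "partial i (xmap F) p"] ex[of "partial i (nmap F) p"]
        ex[of "partial i (smap F) p"] ex[of "partial i (tmap F) p"]
      by (simp add: xn nn ss tt sn tn ts)
  qed
  with smooth have "basic_invariants U F ?a ?b ?e ?f ?g"
    unfolding basic_invariants_def by blast
  then show ?thesis by (rule that)
qed

section \<open>The two operations\<close>

lemma St_components:
  "xmap (St lam th F) p = xmap F p + lam p *\<^sub>R smap F p"
  "nmap (St lam th F) p = cos (th p) *\<^sub>R tmap F p - sin (th p) *\<^sub>R nmap F p"
  "smap (St lam th F) p = sin (th p) *\<^sub>R tmap F p + cos (th p) *\<^sub>R nmap F p"
  by (simp_all add: St_def xmap_def nmap_def smap_def)

lemma Ts_components:
  "xmap (Ts lam th F) p = xmap F p + lam p *\<^sub>R tmap F p"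
  "nmap (Ts lam th F) p = sin (th p) *\<^sub>R nmap F p + cos (th p) *\<^sub>R smap F p"
  "smap (Ts lam th F) p = tmap F p"
  by (simp_all add: Ts_def xmap_def nmap_def smap_def)

lemma frame_cross_products:
  assumes "framed_surface U F" "p \<in> U"
  shows "cross3 (tmap F p) (nmap F p) = smap F p" "cross3 (smap F p) (tmap F p) = nmap F p"
    "cross3 (nmap F p) (tmap F p) = - smap F p"
proof -
  note fr = framed_surface_frame[OF assms]
  show 1: "cross3 (tmap F p) (nmap F p) = smap F p"
    by (simp add: tmap_def triple_cross fr)
  show "cross3 (smap F p) (tmap F p) = nmap F p"
    using cross_skew[of "smap F p" "tmap F p"] by (simp add: tmap_def triple_cross fr)
  show "cross3 (nmap F p) (tmap F p) = - smap F p"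
    using 1 cross_skew by metis
qed

lemma scaleR_sin_cos:
  fixes v :: "'a::real_vector" and y :: real
  shows "(sin y * sin y) *\<^sub>R v + (cos y * cos y) *\<^sub>R v = v"
    and "(cos y * cos y) *\<^sub>R v + (sin y * sin y) *\<^sub>R v = v"
  by (simp_all add: scaleR_add_left[symmetric] sin_squared_eq flip: power2_eq_square)

lemma tmap_St:
  assumes "framed_surface U F" "p \<in> U"
  shows "tmap (St lam th F) p = smap F p"
  using frame_cross_products[OF assms]
  by (simp add: tmap_def[of "St lam th F"] St_components cross_add_left cross_add_right
      Cross3.left_diff_distrib Cross3.right_diff_distrib cross_mult_left cross_mult_right
      scaleR_sin_cos)

lemma tmap_Ts:
  assumes "framed_surface U F" "p \<in> U"
  shows "tmap (Ts lam th F) p = cos (th p) *\<^sub>R nmap F p - sin (th p) *\<^sub>R smap F p"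
  using frame_cross_products[OF assms]
  by (simp add: tmap_def[of "Ts lam th F"] Ts_components cross_add_left cross_mult_left)

lemma Ts_St_inverse:
  assumes "framed_surface U F" "p \<in> U"
  shows "Ts (\<lambda>p. - lam p) (\<lambda>p. - th p) (St lam th F) p = F p"
  by (simp add: Ts_def St_components tmap_St[OF assms] algebra_simps scaleR_sin_cos)
    (simp add: xmap_def nmap_def smap_def)

lemma St_Ts_inverse:
  assumes "framed_surface U F" "p \<in> U"
  shows "St (\<lambda>p. - lam p) (\<lambda>p. - th p) (Ts lam th F) p = F p"
  by (simp add: St_def Ts_components tmap_Ts[OF assms] algebra_simps scaleR_sin_cos)
    (simp add: xmap_def nmap_def smap_def)

text \<open>
  The left-hand side of the condition for forming an operation measures how far the
  transformed \<open>n\<close> is from being normal to the transformed \<open>x\<close>.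
\<close>
lemma St_tangency:
  assumes U: "open U" and F: "framed_surface U F" and I: "basic_invariants U F a b e f g"
    and lam: "lam differentiable (at p)" and p: "p \<in> U"
  shows "partial i (xmap (St lam th F)) p \<bullet> nmap (St lam th F) p =
    lam p * e i p * sin (th p) + (b i p + lam p * g i p) * cos (th p)"
proof -
  note df = framed_surface_smooth_maps[OF U F, THEN smooth_on_imp_differentiable, OF p]
  have "partial i (xmap (St lam th F)) p =
      partial i (xmap F) p + (lam p *\<^sub>R partial i (smap F) p + partial i lam p *\<^sub>R smap F p)"
    using df lam by (simp add: St_components[abs_def] partial_add partial_scaleR differentiable_scaleR)
  also have "\<dots> = (a i p *\<^sub>R smap F p + b i p *\<^sub>R tmap F p)
      + (lam p *\<^sub>R (- e i p *\<^sub>R nmap F p + g i p *\<^sub>R tmap F p) + partial i lam p *\<^sub>R smap F p)"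
    using I p by (simp add: basic_invariants_def)
  finally have deriv: "partial i (xmap (St lam th F)) p = \<dots>" .
  show ?thesis
    unfolding deriv
    by (simp add: St_components inner_simps framed_surface_frame[OF F p] algebra_simps)
qed

lemma Ts_tangency:
  assumes U: "open U" and F: "framed_surface U F" and I: "basic_invariants U F a b e f g"
    and lam: "lam differentiable (at p)" and p: "p \<in> U"
  shows "partial i (xmap (Ts lam th F)) p \<bullet> nmap (Ts lam th F) p =
    - lam p * f i p * sin (th p) + (a i p - lam p * g i p) * cos (th p)"
proof -
  note df = framed_surface_smooth_maps[OF U F, THEN smooth_on_imp_differentiable, OF p]
  have "partial i (xmap (Ts lam th F)) p =
      partial i (xmap F) p + (lam p *\<^sub>R partial i (tmap F) p + partial i lam p *\<^sub>R tmap F p)"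
    using df lam by (simp add: Ts_components[abs_def] partial_add partial_scaleR differentiable_scaleR)
  also have "\<dots> = (a i p *\<^sub>R smap F p + b i p *\<^sub>R tmap F p)
      + (lam p *\<^sub>R (- f i p *\<^sub>R nmap F p - g i p *\<^sub>R smap F p) + partial i lam p *\<^sub>R tmap F p)"
    using I p by (simp add: basic_invariants_def)
  finally have deriv: "partial i (xmap (Ts lam th F)) p = \<dots>" .
  show ?thesis
    unfolding deriv
    by (simp add: Ts_components inner_simps framed_surface_frame[OF F p] algebra_simps)
qed

lemma framed_surface_St:
  assumes U: "open U" and F: "framed_surface U F" and I: "basic_invariants U F a b e f g"
    and C: "St_condition U b e g lam th"
  shows "framed_surface U (St lam th F)"
proof -
  have lam: "smooth_on U lam" and th: "smooth_on U th" using C by (auto simp: St_condition_def)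
  have "smooth_on U (St lam th F)"
    unfolding St_def
    by (intro smooth_on_Pair[OF U] smooth_on_add[OF U] smooth_on_diff[OF U] smooth_on_scaleR[OF U]
        smooth_on_sin[OF U] smooth_on_cos[OF U] framed_surface_smooth_maps[OF U F] lam th)
  moreover have "(nmap (St lam th F) p, smap (St lam th F) p) \<in> Delta" if "p \<in> U" for p
    by (simp add: Delta_def norm_eq_1 St_components inner_simps framed_surface_frame[OF F that]
        sin_squared_eq flip: power2_eq_square)
  moreover have "partial i (xmap (St lam th F)) p \<bullet> nmap (St lam th F) p = 0" if "p \<in> U" for p i
    using St_tangency[OF U F I smooth_on_imp_differentiable[OF lam that] that] C that
    by (simp add: St_condition_def)
  ultimately show ?thesis by (simp add: framed_surface_def)
qed

lemma framed_surface_Ts: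
  assumes U: "open U" and F: "framed_surface U F" and I: "basic_invariants U F a b e f g"
    and C: "Ts_condition U a f g lam th"
  shows "framed_surface U (Ts lam th F)"
proof -
  have lam: "smooth_on U lam" and th: "smooth_on U th" using C by (auto simp: Ts_condition_def)
  have "smooth_on U (Ts lam th F)"
    unfolding Ts_def
    by (intro smooth_on_Pair[OF U] smooth_on_add[OF U] smooth_on_scaleR[OF U]
        smooth_on_sin[OF U] smooth_on_cos[OF U] framed_surface_smooth_maps[OF U F] lam th)
  moreover have "(nmap (Ts lam th F) p, smap (Ts lam th F) p) \<in> Delta" if "p \<in> U" for p
    by (simp add: Delta_def norm_eq_1 Ts_components inner_simps framed_surface_frame[OF F that]
        flip: power2_eq_square)
  moreover have "partial i (xmap (Ts lam th F)) p \<bullet> nmap (Ts lam th F) p = 0" if "p \<in> U" for p i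
    using Ts_tangency[OF U F I smooth_on_imp_differentiable[OF lam that] that] C that
    by (simp add: Ts_condition_def)
  ultimately show ?thesis by (simp add: framed_surface_def)
qed

text \<open>
  Applied to the composition of the two operations, which equals \<open>F\<close> on \<open>U\<close>, this yields
  the condition for the second one. Openness of \<open>U\<close> is what carries the agreement over to the
  derivatives.
\<close>
lemma tangent_if_agrees_with_framed_surface:
  assumes U: "open U" and F: "framed_surface U F" and eq: "\<And>q. q \<in> U \<Longrightarrow> G q = F q" and p: "p \<in> U"
  shows "partial i (xmap G) p \<bullet> nmap G p = 0"
proof -
  have "partial i (xmap G) p = partial i (xmap F) p"
    using framed_surface_smooth_maps(1)[OF U F] p
    by (intro partial_cong_open[OF U p]) (auto simp: xmap_def eq intro: smooth_on_imp_differentiable)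
  moreover have "nmap G p = nmap F p" by (simp add: nmap_def eq p)
  ultimately show ?thesis using F p by (simp add: framed_surface_def)
qed

lemma Ts_condition_after_St:
  assumes U: "open U" and F: "framed_surface U F" and G: "framed_surface U (St lam th F)"
    and I: "basic_invariants U (St lam th F) a' b' e' f' g'"
    and lam: "smooth_on U lam" and th: "smooth_on U th"
  shows "Ts_condition U a' f' g' (\<lambda>p. - lam p) (\<lambda>p. - th p)"
proof -
  have minus: "smooth_on U (\<lambda>p. - lam p)" "smooth_on U (\<lambda>p. - th p)"
    using smooth_on_minus[OF U] lam th by auto
  show ?thesis
    unfolding Ts_condition_def
  proof (intro conjI ballI allI minus)
    fix p i assume p: "p \<in> U"
    show "- (- lam p) * f' i p * sin (- th p) + (a' i p - - lam p * g' i p) * cos (- th p) = 0"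
      using Ts_tangency[OF U G I smooth_on_imp_differentiable[OF minus(1) p] p, of i "\<lambda>p. - th p"]
        tangent_if_agrees_with_framed_surface[OF U F Ts_St_inverse[OF F] p]
      by simp
  qed
qed

lemma St_condition_after_Ts:
  assumes U: "open U" and F: "framed_surface U F" and G: "framed_surface U (Ts lam th F)"
    and I: "basic_invariants U (Ts lam th F) a' b' e' f' g'"
    and lam: "smooth_on U lam" and th: "smooth_on U th"
  shows "St_condition U b' e' g' (\<lambda>p. - lam p) (\<lambda>p. - th p)"
proof -
  have minus: "smooth_on U (\<lambda>p. - lam p)" "smooth_on U (\<lambda>p. - th p)"
    using smooth_on_minus[OF U] lam th by auto
  show ?thesis
    unfolding St_condition_def
  proof (intro conjI ballI allI minus)
    fix p i assume p: "p \<in> U"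
    show "- lam p * e' i p * sin (- th p) + (b' i p + - lam p * g' i p) * cos (- th p) = 0"
      using St_tangency[OF U G I smooth_on_imp_differentiable[OF minus(1) p] p, of i "\<lambda>p. - th p"]
        tangent_if_agrees_with_framed_surface[OF U F St_Ts_inverse[OF F] p]
      by simp
  qed
qed

theorem theorem5p4:
  fixes U :: "(real^2) set"
    and F :: framed_map
    and a b e f g :: "2 \<Rightarrow> real^2 \<Rightarrow> real"
  assumes "plane_domain U"
    and "framed_surface U F"
    and "basic_invariants U F a b e f g"
  shows
    "(\<forall>lam th. St_condition U b e g lam th \<longrightarrow>
        framed_surface U (St lam th F) \<and>
        (\<exists>a' b' e' f' g'. basic_invariants U (St lam th F) a' b' e' f' g' \<and>
           Ts_condition U a' f' g' (\<lambda>p. - lam p) (\<lambda>p. - th p)) \<and>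
        (\<forall>p\<in>U. Ts (\<lambda>p. - lam p) (\<lambda>p. - th p) (St lam th F) p = F p)) \<and>
     (\<forall>lam th. Ts_condition U a f g lam th \<longrightarrow>
        framed_surface U (Ts lam th F) \<and>
        (\<exists>a' b' e' f' g'. basic_invariants U (Ts lam th F) a' b' e' f' g' \<and>
           St_condition U b' e' g' (\<lambda>p. - lam p) (\<lambda>p. - th p)) \<and>
        (\<forall>p\<in>U. St (\<lambda>p. - lam p) (\<lambda>p. - th p) (Ts lam th F) p = F p))"
proof (intro conjI allI impI)
  have U: "open U" using assms(1) by (simp add: plane_domain_def)
  note F = assms(2) and I = assms(3)
  {
    fix lam th assume C: "St_condition U b e g lam th"
    show G: "framed_surface U (St lam th F)"
      using framed_surface_St[OF U F I C] .
    obtain a' b' e' f' g' where I': "basic_invariants U (St lam th F) a' b' e' f' g'"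
      using framed_surface_has_basic_invariants[OF U G] .
    then show "\<exists>a' b' e' f' g'. basic_invariants U (St lam th F) a' b' e' f' g' \<and>
        Ts_condition U a' f' g' (\<lambda>p. - lam p) (\<lambda>p. - th p)"
      using Ts_condition_after_St[OF U F G I'] C unfolding St_condition_def by blast
    show "\<forall>p\<in>U. Ts (\<lambda>p. - lam p) (\<lambda>p. - th p) (St lam th F) p = F p"
      using Ts_St_inverse[OF F] by blast
  }
  {
    fix lam th assume C: "Ts_condition U a f g lam th"
    show G: "framed_surface U (Ts lam th F)"
      using framed_surface_Ts[OF U F I C] .
    obtain a' b' e' f' g' where I': "basic_invariants U (Ts lam th F) a' b' e' f' g'"
      using framed_surface_has_basic_invariants[OF U G] .
    then show "\<exists>a' b' e' f' g'. basic_invariants U (Ts lam th F) a' b' e' f' g' \<and>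
        St_condition U b' e' g' (\<lambda>p. - lam p) (\<lambda>p. - th p)"
      using St_condition_after_Ts[OF U F G I'] C unfolding Ts_condition_def by blast
    show "\<forall>p\<in>U. St (\<lambda>p. - lam p) (\<lambda>p. - th p) (Ts lam th F) p = F p"
      using St_Ts_inverse[OF F] by blast
  }
qed

end
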